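(* Let $\mathbb{X},\mathbb{Y}$ be Banach spaces. Suppose that $B_{\mathbb{X}}$ is the closed convex hull of its strongly exposed points. Then exactly one of the following holds true: (i) $\mathbb{K}(\mathbb{X},\mathbb{Y})=\mathbb{L}(\mathbb{X},\mathbb{Y})$; (ii) $\mathbb{K}(\mathbb{X},\mathbb{Y})$ is strongly anti-coproximinal in $\mathbb{L}(\mathbb{X},\mathbb{Y})$ (as a proper subspace).
   Context: Banach spaces are over the field $\mathbb{K}=\mathbb{R}$ or $\mathbb{C}$ (the same field for $\mathbb{X}$ and $\mathbb{Y}$); $B_{\mathbb{X}}$ and $S_{\mathbb{X}}$ denote the closed unit ball and unit sphere of $\mathbb{X}$. $\mathbb{L}(\mathbb{X},\mathbb{Y})$ is the Banach space of all bounded linear operators from $\mathbb{X}$ to $\mathbb{Y}$ with the operator norm, and $\mathbb{K}(\mathbb{X},\mathbb{Y})$ its subspace of compact operators. For nonzero $x\in\mathbb{X}$, $J(x)=\{x^*\in S_{\mathbb{X}^*}: x^*(x)=\|x\|\}$. A point $x\in S_{\mathbb{X}}$ is a strongly exposed point of $B_{\mathbb{X}}$ if there exists $x^*\in J(x)$ such that for any sequence $\{x_n\}\subset B_{\mathbb{X}}$, $x^*(x_n)\to 1=x^*(x)$ implies $x_n\to x$ in norm. For a Banach space $\mathbb{V}$, $\epsilon\in[0,1)$ and $u,v\in\mathbb{V}$, write $u\perp_B^{\epsilon} v$ if $\|u+\lambda v\|\ge \|u\|-\epsilon\|\lambda v\|$ for every scalar $\lambda$. For a subspace $\mathbb{W}$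 of $\mathbb{V}$ and $v\in\mathbb{V}$, an element $w_0\in\mathbb{W}$ is an $\epsilon$-best coapproximation to $v$ out of $\mathbb{W}$ if $w\perp_B^{\epsilon}(v-w_0)$ for all $w\in\mathbb{W}$. The subspace $\mathbb{W}$ is strongly anti-coproximinal in $\mathbb{V}$ if for every $v\in\mathbb{V}\setminus\mathbb{W}$ and every $\epsilon\in[0,1)$ there is no $\epsilon$-best coapproximation to $v$ out of $\mathbb{W}$. *)

theory Defs
  imports "HOL-Analysis.Analysis"
begin

text \<open>
  The scalar field is the real or the complex numbers: either every element is a real multiple
  of 1, or the field has a square root of -1 that together with 1 spans it over the reals, the
  norm being the usual modulus.
\<close>

class real_or_complex = real_normed_field +
  assumes real_or_complex:
    "(\<forall>z. \<exists>a. z = a *\<^sub>R 1) \<or>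
     (\<exists>i. i * i = - 1 \<and> (\<forall>z. \<exists>a b. z = a *\<^sub>R 1 + b *\<^sub>R i) \<and>
          (\<forall>a b. norm (a *\<^sub>R 1 + b *\<^sub>R i) = sqrt (a\<^sup>2 + b\<^sup>2)))"

instance real :: real_or_complex
  by standard simp

instance complex :: real_or_complex
proof
  have "\<exists>i::complex. i * i = - 1 \<and> (\<forall>z. \<exists>a b. z = a *\<^sub>R 1 + b *\<^sub>R i) \<and>
          (\<forall>a b. norm (a *\<^sub>R 1 + b *\<^sub>R i) = sqrt (a\<^sup>2 + b\<^sup>2))"
  proof (intro exI[of _ \<i>] conjI allI)
    fix z :: complex
    show "\<exists>a b. z = a *\<^sub>R 1 + b *\<^sub>R \<i>"
      by (intro exI[of _ "Re z"] exI[of _ "Im z"]) (simp add: complex_eq_iff)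
  qed (simp_all add: cmod_def)
  then show "(\<forall>z::complex. \<exists>a. z = a *\<^sub>R 1) \<or>
     (\<exists>i::complex. i * i = - 1 \<and> (\<forall>z. \<exists>a b. z = a *\<^sub>R 1 + b *\<^sub>R i) \<and>
          (\<forall>a b. norm (a *\<^sub>R 1 + b *\<^sub>R i) = sqrt (a\<^sup>2 + b\<^sup>2)))" ..
qed

text \<open>
  The library's normed spaces are real. A normed space over the field \<open>'k\<close> is a real one with
  a further scalar multiplication that extends the real scalar multiplication and for which the
  norm is homogeneous. It is a Banach space when its type is in class \<open>banach\<close>.
\<close>

locale normed_space_over = vector_space scale
  for scale :: "'k::real_or_complex \<Rightarrow> 'a::real_normed_vector \<Rightarrow> 'a" +
  assumes scale_of_real: "scale (of_real r) x = r *\<^sub>R x"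
    and norm_scale: "norm (scale c x) = norm c * norm x"

lemma normed_space_over_real:
  "normed_space_over (scaleR :: real \<Rightarrow> 'a::real_normed_vector \<Rightarrow> 'a)"
  by unfold_locales (simp_all add: algebra_simps)

lemma normed_space_over_scalars:
  "normed_space_over ((*) :: 'k::real_or_complex \<Rightarrow> 'k \<Rightarrow> 'k)"
  by unfold_locales (simp_all add: algebra_simps scaleR_conv_of_real norm_mult)

text \<open>
  Elements of \<open>'a \<Rightarrow>\<^sub>L 'b\<close> are the bounded real-linear maps with the operator norm; bounded
  operators over the field \<open>'k\<close> are those that are also linear over \<open>'k\<close>.
\<close>

definition bounded_operators ::
  "('k::real_or_complex \<Rightarrow> 'a::real_normed_vector \<Rightarrow> 'a) \<Rightarrow>
   ('k \<Rightarrow> 'b::real_normed_vector \<Rightarrow> 'b) \<Rightarrow> ('a \<Rightarrow>\<^sub>L 'b) set" where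
  "bounded_operators sX sY = {T. Vector_Spaces.linear sX sY (blinfun_apply T)}"

definition compact_operators ::
  "('k::real_or_complex \<Rightarrow> 'a::real_normed_vector \<Rightarrow> 'a) \<Rightarrow>
   ('k \<Rightarrow> 'b::real_normed_vector \<Rightarrow> 'b) \<Rightarrow> ('a \<Rightarrow>\<^sub>L 'b) set" where
  "compact_operators sX sY =
     {T \<in> bounded_operators sX sY. compact (closure (blinfun_apply T ` cball 0 1))}"

definition operator_scale ::
  "('k::real_or_complex \<Rightarrow> 'b::real_normed_vector \<Rightarrow> 'b) \<Rightarrow>
   'k \<Rightarrow> ('a::real_normed_vector \<Rightarrow>\<^sub>L 'b) \<Rightarrow> ('a \<Rightarrow>\<^sub>L 'b)" where
  "operator_scale sY c T = Blinfun (\<lambda>x. sY c (blinfun_apply T x))"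

lemma operator_scale_apply:
  assumes "normed_space_over sY"
  shows "blinfun_apply (operator_scale sY c T) x = sY c (blinfun_apply T x)"
proof -
  interpret normed_space_over sY by fact
  have "bounded_linear (sY c)"
  proof (rule bounded_linear_intro[where K = "norm c"])
    fix r :: real and x
    show "sY c (r *\<^sub>R x) = r *\<^sub>R sY c x"
      by (metis scale_of_real scale_left_commute)
  qed (simp_all add: scale_right_distrib norm_scale mult.commute)
  then have "bounded_linear (\<lambda>x. sY c (blinfun_apply T x))"
    by (rule bounded_linear_compose) (rule blinfun.bounded_linear_right)
  then show ?thesis
    by (simp add: operator_scale_def bounded_linear_Blinfun_apply)
qed

definition support_functionals ::
  "('k::real_or_complex \<Rightarrow> 'a::real_normed_vector \<Rightarrow> 'a) \<Rightarrow> 'a \<Rightarrow> ('a \<Rightarrow>\<^sub>L 'k) set" where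
  "support_functionals sX x =
     {f \<in> bounded_operators sX (*). norm f = 1 \<and> blinfun_apply f x = of_real (norm x)}"

definition strongly_exposed_point ::
  "('k::real_or_complex \<Rightarrow> 'a::real_normed_vector \<Rightarrow> 'a) \<Rightarrow> 'a \<Rightarrow> bool" where
  "strongly_exposed_point sX x \<longleftrightarrow>
     norm x = 1 \<and>
     (\<exists>f \<in> support_functionals sX x. \<forall>xs :: nat \<Rightarrow> 'a.
        (\<forall>n. xs n \<in> cball 0 1) \<longrightarrow> (\<lambda>n. blinfun_apply f (xs n)) \<longlonglongrightarrow> 1 \<longrightarrow> xs \<longlonglongrightarrow> x)"

definition approx_orthogonal ::
  "('k::real_or_complex \<Rightarrow> 'v::real_normed_vector \<Rightarrow> 'v) \<Rightarrow> real \<Rightarrow> 'v \<Rightarrow> 'v \<Rightarrow> bool" where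
  "approx_orthogonal s \<epsilon> u v \<longleftrightarrow>
     (\<forall>c. norm (u + s c v) \<ge> norm u - \<epsilon> * norm (s c v))"

definition best_coapproximation ::
  "('k::real_or_complex \<Rightarrow> 'v::real_normed_vector \<Rightarrow> 'v) \<Rightarrow> real \<Rightarrow> 'v set \<Rightarrow> 'v \<Rightarrow> 'v \<Rightarrow> bool" where
  "best_coapproximation s \<epsilon> W v w0 \<longleftrightarrow>
     w0 \<in> W \<and> (\<forall>w\<in>W. approx_orthogonal s \<epsilon> w (v - w0))"

text \<open>
  The ambient space is a carrier \<open>V\<close>, because the operators that are linear over \<open>'k\<close> need not
  fill the type \<open>'a \<Rightarrow>\<^sub>L 'b\<close>.
\<close>

definition strongly_anti_coproximinal ::
  "('k::real_or_complex \<Rightarrow> 'v::real_normed_vector \<Rightarrow> 'v) \<Rightarrow> 'v set \<Rightarrow> 'v set \<Rightarrow> bool" where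
  "strongly_anti_coproximinal s V W \<longleftrightarrow>
     (\<forall>v \<in> V - W. \<forall>\<epsilon>\<in>{0..<1}. \<not> (\<exists>w0. best_coapproximation s \<epsilon> W v w0))"

end

theory Submission
  imports Defs
begin

text \<open>
  More is true: no nonzero bounded operator \<open>S\<close> over the field satisfies
  \<open>w \<bottom>\<^sub>B\<^sup>\<epsilon> S\<close> for all compact operators \<open>w\<close>, and operators \<open>w\<close> of rank one suffice to see this.
  Applied to \<open>S = T - w\<^sub>0\<close> with \<open>T\<close> not compact and \<open>w\<^sub>0\<close> compact, it excludes every
  \<open>\<epsilon>\<close>-best coapproximation.

  Since the unit ball is the closed convex hull of its strongly exposed points, \<open>\<parallel>S x\<parallel>\<close> comes
  arbitrarily close to \<open>\<parallel>S\<parallel>\<close> at strongly exposed points \<open>x\<close>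
  (\<open>norm_almost_attained_at_generating_set\<close>). Let \<open>f\<close> strongly expose such an \<open>x\<close>, and perturb
  \<open>w z = f(z) y\<close>, where \<open>y = S x / \<parallel>S x\<parallel>\<close>, to \<open>w - t S\<close> for a small \<open>t > 0\<close>. If \<open>|f z|\<close> is
  close to 1 for a point \<open>z\<close> of the unit ball, then \<open>z\<close> is close to \<open>f(z) x\<close>
  (\<open>strongly_exposing_functional_uniform\<close>), so that \<open>(w - t S) z\<close> is close to
  \<open>(1 - t \<parallel>S x\<parallel>) f(z) y\<close>; if \<open>|f z|\<close> stays away from 1, then \<open>w z\<close> is short and \<open>t S z\<close> too
  small to make up for it. Hence \<open>\<parallel>w - t S\<parallel>\<close> is about \<open>1 - t \<parallel>S\<parallel>\<close> at most, which is below
  \<open>\<parallel>w\<parallel> - \<epsilon> \<parallel>t S\<parallel>\<close>.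
\<close>

section \<open>Operators over the scalar field\<close>

lemma bounded_operators_iff:
  assumes "normed_space_over sX" and "normed_space_over sY"
  shows "T \<in> bounded_operators sX sY \<longleftrightarrow>
    (\<forall>c x. blinfun_apply T (sX c x) = sY c (blinfun_apply T x))"
proof -
  have "vector_space sX" "vector_space sY"
    using assms by (simp_all add: normed_space_over_def)
  then show ?thesis
    by (simp add: bounded_operators_def Vector_Spaces.linear_iff blinfun.add_right)
qed

lemma bounded_operators_diff:
  assumes "normed_space_over sX" and "normed_space_over sY"
    and "S \<in> bounded_operators sX sY" and "T \<in> bounded_operators sX sY"
  shows "S - T \<in> bounded_operators sX sY"
proof -
  interpret Y: normed_space_over sY by fact
  show ?thesis
    using assms(3,4)
    by (simp add: bounded_operators_iff[OF assms(1,2)] blinfun.diff_left Y.scale_right_diff_distrib)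
qed

lemma operator_scale_of_real:
  assumes "normed_space_over sY"
  shows "operator_scale sY (of_real r) T = r *\<^sub>R T"
proof -
  interpret normed_space_over sY by fact
  show ?thesis
    by (rule blinfun_eqI) (simp add: operator_scale_apply[OF assms] scale_of_real blinfun.scaleR_left)
qed

section \<open>Operators of rank one\<close>

text \<open>The scalar field is locally compact, which makes operators of rank one compact.\<close>

lemma compact_unit_ball_scalars: "compact (cball (0::'k::real_or_complex) 1)"
proof -
  have "\<exists>C. compact C \<and> cball (0::'k) 1 \<subseteq> C"
    using real_or_complex[where 'a = 'k]
  proof
    assume real: "\<forall>z::'k. \<exists>a. z = a *\<^sub>R 1"
    have "compact ((\<lambda>a. a *\<^sub>R (1::'k)) ` cball 0 1)"
      by (intro compact_continuous_image continuous_intros) simp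
    moreover have "cball (0::'k) 1 \<subseteq> (\<lambda>a. a *\<^sub>R (1::'k)) ` cball 0 1"
    proof
      fix z :: 'k assume "z \<in> cball 0 1"
      moreover obtain a where "z = a *\<^sub>R 1" using real by blast
      ultimately show "z \<in> (\<lambda>a. a *\<^sub>R (1::'k)) ` cball 0 1" by auto
    qed
    ultimately show ?thesis by blast
  next
    assume "\<exists>i::'k. i * i = - 1 \<and> (\<forall>z. \<exists>a b. z = a *\<^sub>R 1 + b *\<^sub>R i) \<and>
          (\<forall>a b. norm (a *\<^sub>R 1 + b *\<^sub>R i) = sqrt (a\<^sup>2 + b\<^sup>2))"
    then obtain i :: 'k where span: "\<And>z. \<exists>a b. z = a *\<^sub>R 1 + b *\<^sub>R i"
      and modulus: "\<And>a b. norm (a *\<^sub>R 1 + b *\<^sub>R i) = sqrt (a\<^sup>2 + b\<^sup>2)"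
      by blast
    let ?h = "\<lambda>p::real \<times> real. fst p *\<^sub>R (1::'k) + snd p *\<^sub>R i"
    have "compact (?h ` cball 0 1)"
      by (intro compact_continuous_image continuous_intros) simp
    moreover have "cball (0::'k) 1 \<subseteq> ?h ` cball 0 1"
    proof
      fix z :: 'k assume z: "z \<in> cball 0 1"
      obtain a b where ab: "z = a *\<^sub>R 1 + b *\<^sub>R i" using span by blast
      have "norm (a, b) \<le> 1"
        using z modulus[of a b] ab by (simp add: norm_Pair)
      then show "z \<in> ?h ` cball 0 1"
        using ab by (intro image_eqI[of _ _ "(a, b)"]) auto
    qed
    ultimately show ?thesis by blast
  qed
  then obtain C where "compact C" "cball (0::'k) 1 \<subseteq> C" by blast
  then show ?thesis
    using compact_Int_closed[of C "cball (0::'k) 1"] by (simp add: Int_absorb1)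
qed

lemma (in normed_space_over) bounded_linear_scale_left: "bounded_linear (\<lambda>c. scale c y)"
proof (rule bounded_linear_intro[where K = "norm y"])
  fix r :: real and c
  show "scale (r *\<^sub>R c) y = r *\<^sub>R scale c y"
    by (simp add: scaleR_conv_of_real scale_of_real flip: scale_scale)
qed (simp_all add: scale_left_distrib norm_scale)

lemma exists_rank_one_compact_operator:
  fixes sX :: "'k::real_or_complex \<Rightarrow> 'a::real_normed_vector \<Rightarrow> 'a"
    and sY :: "'k \<Rightarrow> 'b::real_normed_vector \<Rightarrow> 'b"
  assumes X: "normed_space_over sX" and Y: "normed_space_over sY"
    and f: "f \<in> bounded_operators sX (*)" and norm_f: "norm f \<le> 1"
  obtains w where "w \<in> compact_operators sX sY"
    and "\<And>z. blinfun_apply w z = sY (blinfun_apply f z) y"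
proof -
  interpret Y: normed_space_over sY by fact
  have lin: "bounded_linear (\<lambda>c. sY c y)"
    by (rule Y.bounded_linear_scale_left)
  define w where "w = Blinfun (\<lambda>z. sY (blinfun_apply f z) y)"
  have w: "blinfun_apply w z = sY (blinfun_apply f z) y" for z
    unfolding w_def
    by (subst bounded_linear_Blinfun_apply)
      (auto intro: bounded_linear_compose[OF lin] blinfun.bounded_linear_right)
  have "w \<in> bounded_operators sX sY"
    using f by (simp add: bounded_operators_iff[OF X Y] w
        bounded_operators_iff[OF X normed_space_over_scalars])
  moreover have "compact (closure (blinfun_apply w ` cball 0 1))"
  proof -
    have C: "compact ((\<lambda>c. sY c y) ` cball 0 1)"
      by (intro compact_continuous_image compact_unit_ball_scalars
          linear_continuous_on lin)
    have "norm (blinfun_apply f z) \<le> 1" if "norm z \<le> 1" for z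
      using norm_blinfun[of f z] norm_f that
      by (meson mult_le_one norm_ge_zero order_trans)
    then have "blinfun_apply w ` cball 0 1 \<subseteq> (\<lambda>c. sY c y) ` cball 0 1"
      by (auto simp: w)
    then have "closure (blinfun_apply w ` cball 0 1) \<subseteq> (\<lambda>c. sY c y) ` cball 0 1"
      using C by (intro closure_minimal compact_imp_closed)
    then show ?thesis
      using compact_Int_closed[OF C closed_closure] by (metis Int_absorb1)
  qed
  ultimately show ?thesis
    using that w by (auto simp: compact_operators_def)
qed

section \<open>Strongly exposed points\<close>

lemma norm_almost_attained_at_generating_set:
  fixes S :: "'a::real_normed_vector \<Rightarrow>\<^sub>L 'b::real_normed_vector"
  assumes hull: "cball 0 1 \<subseteq> closure (convex hull A)"
    and r: "0 \<le> r" "r < norm S"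
  obtains x where "x \<in> A" and "r < norm (blinfun_apply S x)"
proof -
  have "\<exists>x\<in>A. r < norm (blinfun_apply S x)"
  proof (rule ccontr)
    assume "\<not> ?thesis"
    then have A: "A \<subseteq> blinfun_apply S -` cball 0 r"
      by (auto simp: not_less)
    have "convex (blinfun_apply S -` cball 0 r)"
      by (intro convex_linear_vimage convex_cball bounded_linear.linear
          blinfun.bounded_linear_right)
    moreover have "closed (blinfun_apply S -` cball 0 r)"
      by (intro closed_vimage closed_cball linear_continuous_on blinfun.bounded_linear_right)
    ultimately have ball: "cball 0 1 \<subseteq> blinfun_apply S -` cball 0 r"
      using hull A by (meson closure_minimal hull_minimal order_trans)
    have "norm (blinfun_apply S z) \<le> r * norm z" for z
    proof (cases "z = 0")
      case False
      have "z /\<^sub>R norm z \<in> blinfun_apply S -` cball 0 r"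
        using False by (intro subsetD[OF ball]) simp
      then show ?thesis
        using False by (simp add: blinfun.scaleR_right field_simps)
    qed (simp add: blinfun.zero_right)
    then have "norm S \<le> r"
      using r by (intro norm_blinfun_bound)
    then show False using r by simp
  qed
  then show ?thesis using that by blast
qed

text \<open>
  The sequential definition of strong exposure, in a uniform form that also takes care of all
  scalars of modulus one: the points of the unit ball where \<open>|f|\<close> is almost 1 lie near the
  multiples of \<open>x\<close>.
\<close>

lemma strongly_exposing_functional_uniform:
  fixes sX :: "'k::real_or_complex \<Rightarrow> 'a::real_normed_vector \<Rightarrow> 'a"
  assumes X: "normed_space_over sX" and f: "f \<in> bounded_operators sX (*)"
    and exposing: "\<And>xs :: nat \<Rightarrow> 'a. (\<And>n. xs n \<in> cball 0 1) \<Longrightarrow>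
        (\<lambda>n. blinfun_apply f (xs n)) \<longlonglongrightarrow> 1 \<Longrightarrow> xs \<longlonglongrightarrow> x"
    and norm_f: "norm f \<le> 1" and \<eta>: "\<eta> > 0"
  obtains \<delta> where "0 < \<delta>" and "\<delta> \<le> 1"
    and "\<And>z. norm z \<le> 1 \<Longrightarrow> 1 - \<delta> < norm (blinfun_apply f z) \<Longrightarrow>
           norm (z - sX (blinfun_apply f z) x) < \<eta>"
proof -
  interpret X: normed_space_over sX by fact
  have f_scale: "blinfun_apply f (sX c z) = c * blinfun_apply f z" for c z
    using f by (simp add: bounded_operators_iff[OF X normed_space_over_scalars])
  have "\<exists>\<delta>>0. \<delta> \<le> 1 \<and> (\<forall>z. norm z \<le> 1 \<longrightarrow> 1 - \<delta> < norm (blinfun_apply f z) \<longrightarrow>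
           norm (z - sX (blinfun_apply f z) x) < \<eta>)"
  proof (rule ccontr)
    assume contra: "\<not> ?thesis"
    have "\<exists>z. norm z \<le> 1 \<and> 1 - inverse (real (Suc n)) < norm (blinfun_apply f z) \<and>
            \<eta> \<le> norm (z - sX (blinfun_apply f z) x)" for n
    proof -
      have "0 < inverse (real (Suc n))" "inverse (real (Suc n)) \<le> 1"
        by (simp_all add: field_simps)
      then show ?thesis using contra by (meson not_less)
    qed
    then obtain z where z: "\<And>n. norm (z n) \<le> 1"
      and large: "\<And>n. 1 - inverse (real (Suc n)) < norm (blinfun_apply f (z n))"
      and far: "\<And>n. \<eta> \<le> norm (z n - sX (blinfun_apply f (z n)) x)"
      by metis
    define m where "m n = norm (blinfun_apply f (z n))" for n
    \<comment> \<open>Rotating \<open>z n\<close> by \<open>c n\<close> makes the value of \<open>f\<close> there real and positive.\<close>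
    define c where "c n = of_real (m n) / blinfun_apply f (z n)" for n
    have nonzero: "blinfun_apply f (z n) \<noteq> 0" for n
    proof -
      have "inverse (real (Suc n)) \<le> 1" by (simp add: field_simps)
      then show ?thesis using large[of n] by auto
    qed
    have norm_c: "norm (c n) = 1" for n
      using nonzero[of n] by (simp add: c_def m_def norm_divide)
    have fc: "c n * blinfun_apply f (z n) = of_real (m n)" for n
      using nonzero[of n] by (simp add: c_def)
    have m_lim: "m \<longlonglongrightarrow> 1"
    proof (rule tendsto_sandwich)
      show "(\<lambda>n. 1 - inverse (real (Suc n))) \<longlonglongrightarrow> 1"
        using tendsto_diff[OF tendsto_const LIMSEQ_inverse_real_of_nat, of 1] by simp
      show "(\<lambda>n. 1) \<longlonglongrightarrow> (1::real)" by simp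
      show "\<forall>\<^sub>F n in sequentially. 1 - inverse (real (Suc n)) \<le> m n"
        using large by (intro always_eventually) (simp add: m_def less_imp_le)
      have "m n \<le> 1" for n
        using norm_blinfun[of f "z n"] norm_f z[of n] unfolding m_def
        by (meson mult_le_one norm_ge_zero order_trans)
      then show "\<forall>\<^sub>F n in sequentially. m n \<le> 1" by simp
    qed
    have "(\<lambda>n. of_real (m n) :: 'k) \<longlonglongrightarrow> 1"
      using tendsto_of_real[OF m_lim, where 'a = 'k] by simp
    then have "(\<lambda>n. sX (c n) (z n)) \<longlonglongrightarrow> x"
      using z by (intro exposing) (simp_all add: f_scale fc X.norm_scale norm_c)
    then have "(\<lambda>n. norm (sX (c n) (z n) - m n *\<^sub>R x)) \<longlonglongrightarrow> norm (x - 1 *\<^sub>R x)"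
      by (intro tendsto_intros m_lim)
    moreover have "norm (z n - sX (blinfun_apply f (z n)) x) = norm (sX (c n) (z n) - m n *\<^sub>R x)"
      for n
    proof -
      have "sX (c n) (z n - sX (blinfun_apply f (z n)) x) = sX (c n) (z n) - m n *\<^sub>R x"
        by (simp add: X.scale_right_diff_distrib fc X.scale_of_real)
      then show ?thesis
        using X.norm_scale[of "c n"] norm_c[of n] by (metis mult_1)
    qed
    ultimately have "(\<lambda>n. norm (z n - sX (blinfun_apply f (z n)) x)) \<longlonglongrightarrow> 0"
      by simp
    then have "\<eta> \<le> 0"
      by (rule tendsto_lowerbound) (use far in auto)
    then show False using \<eta> by simp
  qed
  then show ?thesis using that by blast
qed

section \<open>Approximate orthogonality of compact operators\<close>

lemma exists_compact_not_approx_orthogonal: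
  fixes sX :: "'k::real_or_complex \<Rightarrow> 'a::real_normed_vector \<Rightarrow> 'a"
    and sY :: "'k \<Rightarrow> 'b::real_normed_vector \<Rightarrow> 'b"
  assumes X: "normed_space_over sX" and Y: "normed_space_over sY"
    and hull: "cball 0 1 \<subseteq> closure (convex hull {x. strongly_exposed_point sX x})"
    and S: "S \<in> bounded_operators sX sY" "S \<noteq> 0"
    and \<epsilon>: "0 \<le> \<epsilon>" "\<epsilon> < 1"
  obtains w where "w \<in> compact_operators sX sY"
    and "\<not> approx_orthogonal (operator_scale sY) \<epsilon> w S"
proof -
  interpret Y: normed_space_over sY by fact
  let ?N = "norm S"
  have N: "?N > 0" using S by simp
  \<comment> \<open>The slack \<open>(1 - \<epsilon>) ?N\<close> is shared: one half for the choice of \<open>x\<close>, a quarter for the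
    distance \<open>\<eta>\<close>, a quarter for the strictness of the final inequality.\<close>
  have "(1 + \<epsilon>) / 2 * ?N < ?N"
    using N \<epsilon> by simp
  then obtain x where x: "strongly_exposed_point sX x"
    and Sx: "(1 + \<epsilon>) / 2 * ?N < norm (blinfun_apply S x)"
    using norm_almost_attained_at_generating_set[OF hull, of "(1 + \<epsilon>) / 2 * ?N" S] \<epsilon> by auto
  let ?s = "norm (blinfun_apply S x)"
  have s: "0 < ?s"
    using Sx N \<epsilon> by (smt (verit) divide_pos_pos mult_pos_pos)
  obtain f where norm_x: "norm x = 1" and f: "f \<in> bounded_operators sX (*)"
    and norm_f: "norm f = 1" and fx: "blinfun_apply f x = 1"
    and exposing: "\<And>xs :: nat \<Rightarrow> 'a. (\<And>n. xs n \<in> cball 0 1) \<Longrightarrow>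
        (\<lambda>n. blinfun_apply f (xs n)) \<longlonglongrightarrow> 1 \<Longrightarrow> xs \<longlonglongrightarrow> x"
    using x by (auto simp: strongly_exposed_point_def support_functionals_def)
  have s_le: "?s \<le> ?N"
    using norm_blinfun[of S x] norm_x by simp
  define \<eta> where "\<eta> = (1 - \<epsilon>) / 4"
  have "\<eta> > 0" using \<epsilon> by (simp add: \<eta>_def)
  then obtain \<delta> where \<delta>: "0 < \<delta>" "\<delta> \<le> 1"
    and near: "\<And>z. norm z \<le> 1 \<Longrightarrow> 1 - \<delta> < norm (blinfun_apply f z) \<Longrightarrow>
           norm (z - sX (blinfun_apply f z) x) < \<eta>"
    using strongly_exposing_functional_uniform[OF X f exposing] norm_f by (metis order_refl)
  define y where "y = blinfun_apply S x /\<^sub>R ?s"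
  have norm_y: "norm y = 1" using s by (simp add: y_def)
  have Sx_eq: "blinfun_apply S x = ?s *\<^sub>R y" using s by (simp add: y_def)
  obtain w where w: "w \<in> compact_operators sX sY"
    and w_apply: "\<And>z. blinfun_apply w z = sY (blinfun_apply f z) y"
    using exists_rank_one_compact_operator[OF X Y f] norm_f by (metis order_refl)
  have norm_w: "1 \<le> norm w"
    using norm_blinfun[of w x] norm_x norm_y by (simp add: w_apply fx)
  \<comment> \<open>With this \<open>t\<close>, where \<open>norm (f z) \<le> 1 - \<delta>\<close> the crude bound \<open>1 - \<delta> + t * ?N\<close> equals
    \<open>1 - t * ?N\<close>.\<close>
  define t where "t = \<delta> / (2 * ?N)"
  have t: "0 < t" and tN: "t * ?N = \<delta> / 2"
    using \<delta> N by (simp_all add: t_def)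
  have ts: "t * ?s \<le> 1"
  proof -
    have "t * ?s \<le> t * ?N" using s_le t by (intro mult_left_mono) simp_all
    then show ?thesis using tN \<delta> by simp
  qed
  define \<kappa> where "\<kappa> = (1 + 3 * \<epsilon>) / 4"
  have \<kappa>: "\<epsilon> < \<kappa>" "\<kappa> \<le> 1" using \<epsilon> by (simp_all add: \<kappa>_def)
  have ball: "norm (blinfun_apply (w - t *\<^sub>R S) z) \<le> 1 - t * ?N * \<kappa>" if z: "norm z \<le> 1" for z
  proof (cases "1 - \<delta> < norm (blinfun_apply f z)")
    case True
    let ?c = "blinfun_apply f z"
    have c: "norm ?c \<le> 1"
      using norm_blinfun[of f z] norm_f z by simp
    have S_scale: "blinfun_apply S (sX ?c x) = ?s *\<^sub>R sY ?c y"
      using S(1) Sx_eq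
      by (metis bounded_operators_iff[OF X Y] Y.scale_of_real Y.scale_left_commute)
    have "blinfun_apply (w - t *\<^sub>R S) z =
        (1 - t * ?s) *\<^sub>R sY ?c y - t *\<^sub>R blinfun_apply S (z - sX ?c x)"
      by (simp add: blinfun.diff_left blinfun.scaleR_left blinfun.diff_right w_apply S_scale
          algebra_simps)
    also have "norm \<dots> \<le> norm ((1 - t * ?s) *\<^sub>R sY ?c y)
        + norm (t *\<^sub>R blinfun_apply S (z - sX ?c x))"
      by (rule norm_triangle_ineq4)
    also have "\<dots> \<le> (1 - t * ?s) + t * (?N * \<eta>)"
    proof (rule add_mono)
      show "norm ((1 - t * ?s) *\<^sub>R sY ?c y) \<le> 1 - t * ?s"
        using ts c by (simp add: Y.norm_scale norm_y mult_left_le)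
      have "norm (blinfun_apply S (z - sX ?c x)) \<le> ?N * norm (z - sX ?c x)"
        by (rule norm_blinfun)
      also have "\<dots> \<le> ?N * \<eta>"
        using near[OF z True] by (intro mult_left_mono) simp_all
      finally show "norm (t *\<^sub>R blinfun_apply S (z - sX ?c x)) \<le> t * (?N * \<eta>)"
        using t by simp
    qed
    also have "\<dots> \<le> 1 - t * ?N * \<kappa>"
    proof -
      have "t * ((1 + \<epsilon>) / 2 * ?N) \<le> t * ?s"
        using Sx t by (intro mult_left_mono) simp_all
      then show ?thesis by (simp add: \<kappa>_def \<eta>_def field_simps)
    qed
    finally show ?thesis .
  next
    case False
    have "norm (blinfun_apply (w - t *\<^sub>R S) z)
        \<le> norm (blinfun_apply w z) + t * norm (blinfun_apply S z)"
      using norm_triangle_ineq4[of "blinfun_apply w z" "t *\<^sub>R blinfun_apply S z"] t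
      by (simp add: blinfun.diff_left blinfun.scaleR_left)
    also have "norm (blinfun_apply w z) \<le> 1 - \<delta>"
      using False by (simp add: w_apply Y.norm_scale norm_y)
    also have "t * norm (blinfun_apply S z) \<le> t * ?N"
      using order_trans[OF norm_blinfun[of S z] mult_left_le[OF z norm_ge_zero]] t
      by (intro mult_left_mono) simp_all
    also have "1 - \<delta> + t * ?N = 1 - t * ?N * 1"
      using tN by simp
    also have "\<dots> \<le> 1 - t * ?N * \<kappa>"
      using \<kappa> t N by (intro diff_left_mono mult_left_mono) simp_all
    finally show ?thesis by simp
  qed
  have tN\<kappa>: "0 \<le> 1 - t * ?N * \<kappa>"
    using ball[of 0] by (simp add: blinfun.zero_right)
  have "norm (w - t *\<^sub>R S) \<le> 1 - t * ?N * \<kappa>"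
  proof (rule ccontr)
    assume "\<not> ?thesis"
    then obtain z where "z \<in> cball 0 1"
      and "1 - t * ?N * \<kappa> < norm (blinfun_apply (w - t *\<^sub>R S) z)"
      using norm_almost_attained_at_generating_set[of "cball 0 1" _ "w - t *\<^sub>R S"] tN\<kappa>
      by (metis convex_cball closed_cball closure_closed hull_same not_less order_refl)
    then show False using ball[of z] by simp
  qed
  also have "\<dots> < norm w - \<epsilon> * norm ((- t) *\<^sub>R S)"
  proof -
    have "\<epsilon> * (t * ?N) < t * ?N * \<kappa>"
      using mult_strict_right_mono[OF \<kappa>(1) mult_pos_pos[OF t N]] by (simp only: mult.commute)
    moreover have "norm ((- t) *\<^sub>R S) = t * ?N" using t by simp
    ultimately show ?thesis using norm_w by (simp only:)
  qed
  finally have "norm (w + operator_scale sY (of_real (- t)) S)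
      < norm w - \<epsilon> * norm (operator_scale sY (of_real (- t)) S)"
    unfolding operator_scale_of_real[OF Y] by simp
  then have "\<not> approx_orthogonal (operator_scale sY) \<epsilon> w S"
    unfolding approx_orthogonal_def by (meson not_less)
  with w show ?thesis by (rule that)
qed

theorem theorem3p42:
  fixes sX :: "'k::real_or_complex \<Rightarrow> 'a::banach \<Rightarrow> 'a"
    and sY :: "'k \<Rightarrow> 'b::banach \<Rightarrow> 'b"
  defines "L \<equiv> bounded_operators sX sY"
    and "K \<equiv> compact_operators sX sY"
  assumes "normed_space_over sX" and "normed_space_over sY"
    and "cball 0 1 = closure (convex hull {x. strongly_exposed_point sX x})"
  shows "(K = L \<or> (K \<subset> L \<and> strongly_anti_coproximinal (operator_scale sY) L K)) \<and>
         \<not> (K = L \<and> (K \<subset> L \<and> strongly_anti_coproximinal (operator_scale sY) L K))"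
proof -
  have sub: "K \<subseteq> L"
    by (auto simp: K_def L_def compact_operators_def)
  have "strongly_anti_coproximinal (operator_scale sY) L K"
    unfolding strongly_anti_coproximinal_def
  proof (intro ballI notI)
    fix T and \<epsilon> :: real
    assume T: "T \<in> L - K" and \<epsilon>: "\<epsilon> \<in> {0..<1}"
      and "\<exists>w0. best_coapproximation (operator_scale sY) \<epsilon> K T w0"
    then obtain w0 where w0: "w0 \<in> K"
      and orth: "\<And>w. w \<in> K \<Longrightarrow> approx_orthogonal (operator_scale sY) \<epsilon> w (T - w0)"
      by (auto simp: best_coapproximation_def)
    have "T - w0 \<in> bounded_operators sX sY"
      using T w0 sub assms(3,4) by (intro bounded_operators_diff) (auto simp: L_def)
    moreover have "T - w0 \<noteq> 0"
      using T w0 by auto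
    ultimately obtain w where "w \<in> K" "\<not> approx_orthogonal (operator_scale sY) \<epsilon> w (T - w0)"
      using exists_compact_not_approx_orthogonal[OF assms(3,4) equalityD1[OF assms(5)]] \<epsilon>
      unfolding K_def by (metis atLeastLessThan_iff)
    then show False using orth by blast
  qed
  with sub show ?thesis by blast
qed

end
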